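(* Consider the problem with observable costs, and let $(\bar S_t)_{t\in\mathbb{N}}$, $\bar S_t=\bar\sigma_t(M_t)\in\bar{\mathcal{S}}$, be an information state for the problem with observable costs. Let $$[\bar{\mathcal{T}}\bar\Lambda](\bar s)=\inf_{u\in\mathcal{U}}\ \sup_{(c,\bar s')\in[[C,\bar S'|\bar s,u]]}\big(c+\gamma\,\bar\Lambda(\bar s')\big),\qquad \bar s\in\bar{\mathcal{S}},$$ and $\bar\Lambda^0\equiv0$, $\bar\Lambda^n=\bar{\mathcal{T}}^n\bar\Lambda^0$. Then for every $n\in\mathbb{N}$, every $t\in\mathbb{N}$ and every feasible memory realization $m_t$, $$\frac{\gamma^{n+t}c^{\min}}{1-\gamma}+\gamma^t\bar\Lambda^n(\bar\sigma_t(m_t))+\sup_{a_t\in[[A_t|m_t]]}a_t\ \le\ V_t(m_t)\ \le\ \sup_{a_t\in[[A_t|m_t]]}a_t+\gamma^t\bar\Lambda^n(\bar\sigma_t(m_t))+\frac{\gamma^{n+t}c^{\max}}{1-\gamma}.$$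
   Context: Setting. $\mathbb{N}=\{0,1,2,\dots\}$, $\gamma\in(0,1)$. The nonempty sets $\mathcal{U},\mathcal{W},\mathcal{Y}$ are bounded subsets of a metric space $(E,\eta)$, and $\mathcal{C}\subset\mathbb{R}_{\ge0}$ is bounded with minimum $c^{\min}$ and maximum $c^{\max}$. An uncertain variable is a map $X:\Omega\to\mathcal{X}$ on a fixed sample space $\Omega$; its range is $[[X]]=\{X(\omega):\omega\in\Omega\}$, joint ranges are ranges of tuples, and the conditional range is $[[X|y]]=\{X(\omega): Y(\omega)=y,\ \omega\in\Omega\}$. Disturbances $W_t\in\mathcal{W}$, $t\in\mathbb{N}$, are independent uncertain variables (joint ranges are products of the individual ranges). The system is given by functions $h_0,h_{t+1},d_t$: with actions $U_t\in\mathcal{U}$, the observations are $Y_0=h_0(W_0)$, $Y_{t+1}=h_{t+1}(W_{0:t},U_{0:t})\in\mathcal{Y}$ and the costs are $C_t=d_t(W_{0:t},U_{0:t})\in\mathcal{C}$. Observable costs: the agent observes incurred costs, so the memory is $M_t=(Y_{0:t},C_{0:t-1},U_{0:t-1})$ (with $M_0=Y_0$), with values in $\mathcal{M}_t$ (the product of the corresponding copies of $\mathcal{Y},\mathcal{C},\mathcal{U}$). A strategy is $\boldsymbol g=(g_0,g_1,\dots)$ with arbitrary $g_t:\mathcal{M}_t\to\mathcal{U}$ and $U_t=g_t(M_t)$; $\mathcal{G}$ is the set of strategies. A memory realization $m_t=(y_{0:t},c_{0:t-1},u_{0:t-1})$ is feasible if some disturbance realization produces observations $y_{0:t}$ and costs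 $c_{0:t-1}$ under actions $u_{0:t-1}$. Ranges conditioned on $m_t$ (or on $(m_t,u_t)$) are taken over all $\omega\in\Omega$ whose disturbances produce $y_{0:t},c_{0:t-1}$ under $u_{0:t-1}$, the past actions being $u_{0:t-1}$ (and the action at $t$ being $u_t$). A superscript $\boldsymbol g$ means that in addition all actions from time $t$ on are generated by $\boldsymbol g$. The accrued cost is $A_t=\sum_{\ell=0}^{t-1}\gamma^\ell C_\ell$ ($A_0=0$); the cost-to-go is $C_t^\infty=\sum_{\ell=t}^\infty\gamma^{\ell-t}C_\ell$. Value functions: $V_t^{\boldsymbol g}(m_t)=\sup_{(a_t,c_t^\infty)\in[[A_t,C_t^\infty|m_t]]^{\boldsymbol g}}(a_t+\gamma^tc_t^\infty)$ and $V_t(m_t)=\inf_{\boldsymbol g\in\mathcal{G}}V_t^{\boldsymbol g}(m_t)$. Information state (observable costs): uncertain variables $\bar S_t=\bar\sigma_t(M_t)$, $t\in\mathbb{N}$, with values in a bounded, time-invariant set $\bar{\mathcal{S}}$, such that for all $t\in\mathbb{N}$, all feasible $m_t$ and all $u_t\in\mathcal{U}$, $$[[C_t,\bar S_{t+1}|m_t,u_t]]=[[C_t,\bar S_{t+1}|\bar\sigma_t(m_t),u_t]],$$ where $[[C_t,\bar S_{t+1}|\bar s,u]]$ is the union of $[[C_t,\bar S_{t+1}|m_t,u]]$ over all feasible $m_t$ with $\bar\sigma_t(m_t)=\bar s$. These conditional ranges are time-invariant: there is a map $(\bar s,u)\mapsto[[C,\bar S'|\bar s,u]]$ from $\bar{\mathcal{S}}\times\mathcal{U}$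 to nonempty subsets of $\mathcal{C}\times\bar{\mathcal{S}}$ with $[[C_t,\bar S_{t+1}|\bar s,u]]=[[C,\bar S'|\bar s,u]]$ for every $t$, every $u$ and every $\bar s$ that is the value $\bar\sigma_t(m_t)$ of some feasible $m_t$. The operator $\bar{\mathcal{T}}$ acts on uniformly bounded functions $\bar\Lambda:\bar{\mathcal{S}}\to\mathbb{R}$. *)

theory Defs
  imports "HOL-Analysis.Analysis"
begin

text \<open>
  Finite tuples such as \<open>w\<^sub>0, \<dots>, w\<^sub>t\<close> are lists (entry \<open>i\<close> at position \<open>i\<close>), so that
  quantities with different horizons live in one type.  \<open>obs_map P 0\<close> is not used:
  the initial observation is given by \<open>obs_map0\<close>.
\<close>

record ('o, 'e) system =
  sample_space :: "'o set"
  disturbance_set :: "'e set"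
  action_set :: "'e set"
  observation_set :: "'e set"
  cost_set :: "real set"
  discount :: real
  disturbance :: "nat \<Rightarrow> 'o \<Rightarrow> 'e"
  obs_map0 :: "'e \<Rightarrow> 'e"
  obs_map :: "nat \<Rightarrow> 'e list \<Rightarrow> 'e list \<Rightarrow> 'e"
  cost_map :: "nat \<Rightarrow> 'e list \<Rightarrow> 'e list \<Rightarrow> real"

type_synonym 'e mem = "'e list \<times> real list \<times> 'e list"

definition tuples :: "'a set \<Rightarrow> nat \<Rightarrow> 'a list set" where
  "tuples A n = {xs. length xs = n \<and> set xs \<subseteq> A}"

definition independent_uvs :: "'o set \<Rightarrow> (nat \<Rightarrow> 'o \<Rightarrow> 'e) \<Rightarrow> bool" where
  "independent_uvs Om W \<longleftrightarrow>
     (\<forall>J. finite J \<and> J \<noteq> {} \<longrightarrow>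
        (\<lambda>\<omega>. restrict (\<lambda>i. W i \<omega>) J) ` Om = (\<Pi>\<^sub>E i\<in>J. W i ` Om))"

definition uncertain_system :: "('o, 'e::metric_space) system \<Rightarrow> bool" where
  "uncertain_system P \<longleftrightarrow>
     0 < discount P \<and> discount P < 1 \<and>
     disturbance_set P \<noteq> {} \<and> bounded (disturbance_set P) \<and>
     action_set P \<noteq> {} \<and> bounded (action_set P) \<and>
     observation_set P \<noteq> {} \<and> bounded (observation_set P) \<and>
     cost_set P \<subseteq> {0..} \<and> bounded (cost_set P) \<and>
     (\<forall>t. disturbance P t \<in> sample_space P \<rightarrow> disturbance_set P) \<and>
     independent_uvs (sample_space P) (disturbance P) \<and>
     obs_map0 P \<in> disturbance_set P \<rightarrow> observation_set P \<and>
     (\<forall>t. \<forall>ws \<in> tuples (disturbance_set P) (Suc t). \<forall>us \<in> tuples (action_set P) (Suc t).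
        obs_map P (Suc t) ws us \<in> observation_set P \<and>
        cost_map P t ws us \<in> cost_set P)"

text \<open>
  Below, \<open>w\<close> is a realization of the disturbance sequence and \<open>us\<close> a list of actions,
  starting at time \<open>0\<close>.
\<close>

fun obs_at :: "('o, 'e) system \<Rightarrow> (nat \<Rightarrow> 'e) \<Rightarrow> 'e list \<Rightarrow> nat \<Rightarrow> 'e" where
  "obs_at P w us 0 = obs_map0 P (w 0)"
| "obs_at P w us (Suc t) = obs_map P (Suc t) (map w [0..<Suc t]) (take (Suc t) us)"

definition cost_at :: "('o, 'e) system \<Rightarrow> (nat \<Rightarrow> 'e) \<Rightarrow> 'e list \<Rightarrow> nat \<Rightarrow> real" where
  "cost_at P w us t = cost_map P t (map w [0..<Suc t]) (take (Suc t) us)"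

text \<open>The memory at time \<open>length us\<close>.\<close>

definition memory :: "('o, 'e) system \<Rightarrow> (nat \<Rightarrow> 'e) \<Rightarrow> 'e list \<Rightarrow> 'e mem" where
  "memory P w us =
     (map (obs_at P w us) [0..<Suc (length us)], map (cost_at P w us) [0..<length us], us)"

definition memory_space :: "('o, 'e) system \<Rightarrow> nat \<Rightarrow> 'e mem set" where
  "memory_space P t =
     tuples (observation_set P) (Suc t) \<times> tuples (cost_set P) t \<times> tuples (action_set P) t"

definition past_actions :: "'e mem \<Rightarrow> 'e list" where
  "past_actions m = snd (snd m)"

definition strategies :: "('o, 'e) system \<Rightarrow> (nat \<Rightarrow> 'e mem \<Rightarrow> 'e) set" where
  "strategies P = {g. \<forall>t. g t \<in> memory_space P t \<rightarrow> action_set P}"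

definition consistent :: "('o, 'e) system \<Rightarrow> 'e mem \<Rightarrow> 'o set" where
  "consistent P m =
     {\<omega> \<in> sample_space P. memory P (\<lambda>i. disturbance P i \<omega>) (past_actions m) = m}"

definition feasible :: "('o, 'e) system \<Rightarrow> nat \<Rightarrow> 'e mem \<Rightarrow> bool" where
  "feasible P t m \<longleftrightarrow> m \<in> memory_space P t \<and> consistent P m \<noteq> {}"

text \<open>
  The range, conditioned on the memory realization \<open>m\<close>, of a quantity \<open>X\<close> given as a
  function of the disturbance sequence.
\<close>

definition cond_range ::
    "('o, 'e) system \<Rightarrow> ((nat \<Rightarrow> 'e) \<Rightarrow> 'x) \<Rightarrow> 'e mem \<Rightarrow> 'x set" where
  "cond_range P X m = (\<lambda>\<omega>. X (\<lambda>i. disturbance P i \<omega>)) ` consistent P m"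

text \<open>
  All actions up to time \<open>length us + k - 1\<close>: first \<open>us\<close>, then \<open>k\<close> actions generated by \<open>g\<close>.
\<close>

primrec closed_loop ::
    "('o, 'e) system \<Rightarrow> (nat \<Rightarrow> 'e mem \<Rightarrow> 'e) \<Rightarrow> (nat \<Rightarrow> 'e) \<Rightarrow> 'e list \<Rightarrow> nat \<Rightarrow> 'e list" where
  "closed_loop P g w us 0 = us"
| "closed_loop P g w us (Suc k) =
     (let us' = closed_loop P g w us k in us' @ [g (length us') (memory P w us')])"

definition accrued :: "('o, 'e) system \<Rightarrow> nat \<Rightarrow> (nat \<Rightarrow> 'e) \<Rightarrow> 'e list \<Rightarrow> real" where
  "accrued P t w us = (\<Sum>l<t. discount P ^ l * cost_at P w us l)"

definition cost_to_go ::
    "('o, 'e) system \<Rightarrow> (nat \<Rightarrow> 'e mem \<Rightarrow> 'e) \<Rightarrow> nat \<Rightarrow> (nat \<Rightarrow> 'e) \<Rightarrow> 'e list \<Rightarrow> real" where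
  "cost_to_go P g t w us =
     (\<Sum>k. discount P ^ k * cost_at P w (closed_loop P g w us (Suc k)) (t + k))"

definition accrued_range :: "('o, 'e) system \<Rightarrow> nat \<Rightarrow> 'e mem \<Rightarrow> real set" where
  "accrued_range P t m = cond_range P (\<lambda>w. accrued P t w (past_actions m)) m"

definition strategy_value ::
    "('o, 'e) system \<Rightarrow> (nat \<Rightarrow> 'e mem \<Rightarrow> 'e) \<Rightarrow> nat \<Rightarrow> 'e mem \<Rightarrow> real" where
  "strategy_value P g t m =
     (SUP (a, c) \<in> cond_range P
          (\<lambda>w. (accrued P t w (past_actions m), cost_to_go P g t w (past_actions m))) m.
        a + discount P ^ t * c)"

definition optimal_value :: "('o, 'e) system \<Rightarrow> nat \<Rightarrow> 'e mem \<Rightarrow> real" where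
  "optimal_value P t m = (INF g \<in> strategies P. strategy_value P g t m)"

text \<open>The range of \<open>(C\<^sub>t, S\<^sub>t\<^sub>+\<^sub>1)\<close> given \<open>(m, u)\<close> and given \<open>(s, u)\<close>, respectively.\<close>

definition mem_transition ::
    "('o, 'e) system \<Rightarrow> (nat \<Rightarrow> 'e mem \<Rightarrow> 's) \<Rightarrow> nat \<Rightarrow> 'e mem \<Rightarrow> 'e \<Rightarrow> (real \<times> 's) set" where
  "mem_transition P \<sigma> t m u =
     (let us = past_actions m @ [u]
      in cond_range P (\<lambda>w. (cost_at P w us t, \<sigma> (Suc t) (memory P w us))) m)"

definition state_transition ::
    "('o, 'e) system \<Rightarrow> (nat \<Rightarrow> 'e mem \<Rightarrow> 's) \<Rightarrow> nat \<Rightarrow> 's \<Rightarrow> 'e \<Rightarrow> (real \<times> 's) set" where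
  "state_transition P \<sigma> t s u =
     (\<Union>m \<in> {m. feasible P t m \<and> \<sigma> t m = s}. mem_transition P \<sigma> t m u)"

definition information_state ::
    "('o, 'e) system \<Rightarrow> 's::metric_space set \<Rightarrow> (nat \<Rightarrow> 'e mem \<Rightarrow> 's) \<Rightarrow> bool" where
  "information_state P S \<sigma> \<longleftrightarrow>
     bounded S \<and>
     (\<forall>t. \<sigma> t \<in> memory_space P t \<rightarrow> S) \<and>
     (\<forall>t m. feasible P t m \<longrightarrow>
        (\<forall>u \<in> action_set P. mem_transition P \<sigma> t m u = state_transition P \<sigma> t (\<sigma> t m) u))"

definition time_invariant_transition ::
    "('o, 'e) system \<Rightarrow> 's set \<Rightarrow> (nat \<Rightarrow> 'e mem \<Rightarrow> 's) \<Rightarrow>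
      ('s \<Rightarrow> 'e \<Rightarrow> (real \<times> 's) set) \<Rightarrow> bool" where
  "time_invariant_transition P S \<sigma> K \<longleftrightarrow>
     (\<forall>s \<in> S. \<forall>u \<in> action_set P. K s u \<noteq> {} \<and> K s u \<subseteq> cost_set P \<times> S) \<and>
     (\<forall>t m. feasible P t m \<longrightarrow>
        (\<forall>u \<in> action_set P. state_transition P \<sigma> t (\<sigma> t m) u = K (\<sigma> t m) u))"

definition dp_operator ::
    "('o, 'e) system \<Rightarrow> ('s \<Rightarrow> 'e \<Rightarrow> (real \<times> 's) set) \<Rightarrow> ('s \<Rightarrow> real) \<Rightarrow> 's \<Rightarrow> real" where
  "dp_operator P K \<Lambda> s =
     (INF u \<in> action_set P. SUP (c, s') \<in> K s u. c + discount P * \<Lambda> s')"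

end

theory Submission
  imports Defs
begin

text \<open>
  Incurred costs are part of the memory, so the accrued cost is the same for every realization
  consistent with \<open>m\<close>, and only the worst-case cost-to-go has to be controlled.  The claim is
  that the best achievable one exceeds the \<open>n\<close>-th value iterate at the information state by an
  amount between \<open>\<gamma>\<^sup>n cmin / (1 - \<gamma>)\<close> and \<open>\<gamma>\<^sup>n cmax / (1 - \<gamma>)\<close>, the
  bounds for the discounted total of the costs after \<open>n\<close> further steps.  For \<open>n = 0\<close> this is the
  geometric series; a step from \<open>n\<close> to \<open>n + 1\<close> splits off the current cost.  The information
  state property enters here: the pairs of current cost and next information state, over the
  realizations consistent with \<open>m\<close>, form exactly the set \<open>K (\<sigma> t m) u\<close> (\<open>kernel_eq\<close>).

  For the lower bound (\<open>value_iterate_le_cost_bound\<close>), a number above all costs-to-go after \<open>m\<close>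
  also limits the costs-to-go after every successor memory: what is consistent with the successor
  is consistent with \<open>m\<close> and produces the cost recorded in the successor.  This works for each
  strategy separately, before any infimum is taken.

  For the upper bound (\<open>greedy_cost_to_go_le\<close>), one strategy for each \<open>\<epsilon> > 0\<close> is enough.  Fix the time
  \<open>T = t + n\<close> up to which one plans.  At time \<open>\<tau>\<close> the strategy takes an action that is optimal up
  to \<open>\<epsilon>\<close> for the iterate with \<open>T - \<tau>\<close> steps left, as a function of the information
  state.  The slacks add up to at most \<open>\<epsilon> / (1 - \<gamma>)\<close>, and \<open>\<epsilon>\<close> is arbitrary.
\<close>

section \<open>Memories and closed-loop actions\<close>

lemma obs_at_append:
  "i \<le> length us \<Longrightarrow> obs_at P w (us @ vs) i = obs_at P w us i"
  by (cases i) auto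

lemma cost_at_append:
  "i < length us \<Longrightarrow> cost_at P w (us @ vs) i = cost_at P w us i"
  by (simp add: cost_at_def)

text \<open>Memory is never lost, so a realization consistent with a later memory is consistent with
  the earlier ones.\<close>

lemma memory_eq_butlast:
  assumes "memory P w (us @ [u]) = memory P w' (us @ [u])"
  shows "memory P w us = memory P w' us"
    and "cost_at P w (us @ [u]) (length us) = cost_at P w' (us @ [u]) (length us)"
proof -
  have obs: "\<forall>i \<le> length us. obs_at P w us i = obs_at P w' us i"
    and cost: "\<forall>i < length us. cost_at P w us i = cost_at P w' us i"
    and last: "cost_at P w (us @ [u]) (length us) = cost_at P w' (us @ [u]) (length us)"
    using assms
    by (auto simp: memory_def obs_at_append cost_at_append simp flip: less_Suc_eq_le
        simp del: obs_at.simps elim!: less_SucE)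
  show "memory P w us = memory P w' us"
    using obs cost by (auto simp: memory_def simp flip: less_Suc_eq_le)
  show "cost_at P w (us @ [u]) (length us) = cost_at P w' (us @ [u]) (length us)"
    by (rule last)
qed

lemma past_actions_memory [simp]: "past_actions (memory P w us) = us"
  by (simp add: past_actions_def memory_def)

lemma length_closed_loop [simp]: "length (closed_loop P g w us k) = length us + k"
  by (induction k) (auto simp: Let_def)

lemma closed_loop_Suc_shift:
  "closed_loop P g w us (Suc k) =
   closed_loop P g w (us @ [g (length us) (memory P w us)]) k"
  by (induction k) (auto simp: Let_def)

lemma tuples_take: "us \<in> tuples A n \<Longrightarrow> k \<le> n \<Longrightarrow> take k us \<in> tuples A k"
  using set_take_subset by (fastforce simp: tuples_def)

lemma tuples_snoc: "us \<in> tuples A n \<Longrightarrow> u \<in> A \<Longrightarrow> us @ [u] \<in> tuples A (Suc n)"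
  by (auto simp: tuples_def)

locale cost_bounded_system =
  fixes P :: "('o, 'e::metric_space) system"
    and cmin cmax :: real
  assumes system: "uncertain_system P"
    and cmin_le: "\<And>c. c \<in> cost_set P \<Longrightarrow> cmin \<le> c"
    and cmax_in: "cmax \<in> cost_set P" and le_cmax: "\<And>c. c \<in> cost_set P \<Longrightarrow> c \<le> cmax"
begin

abbreviation "\<gamma> \<equiv> discount P"

abbreviation dist_seq :: "'o \<Rightarrow> nat \<Rightarrow> 'e" where
  "dist_seq \<omega> \<equiv> (\<lambda>i. disturbance P i \<omega>)"

lemma discount: "0 < \<gamma>" "\<gamma> < 1"
  using system by (auto simp: uncertain_system_def)

lemma cost_nonneg: "c \<in> cost_set P \<Longrightarrow> 0 \<le> c"
  using system by (auto simp: uncertain_system_def)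

lemma dist_seq_tuple:
  "\<omega> \<in> sample_space P \<Longrightarrow> map (dist_seq \<omega>) [0..<k] \<in> tuples (disturbance_set P) k"
  using system by (fastforce simp: tuples_def uncertain_system_def)

lemma cost_at_in:
  assumes "\<omega> \<in> sample_space P" "us \<in> tuples (action_set P) n" "i < n"
  shows "cost_at P (dist_seq \<omega>) us i \<in> cost_set P"
  using system dist_seq_tuple[OF assms(1), of "Suc i"] tuples_take[OF assms(2), of "Suc i"] assms(3)
  unfolding cost_at_def uncertain_system_def by auto

lemma obs_at_in:
  assumes "\<omega> \<in> sample_space P" "us \<in> tuples (action_set P) n" "i \<le> n"
  shows "obs_at P (dist_seq \<omega>) us i \<in> observation_set P"
proof (cases i)
  case 0
  have "dist_seq \<omega> 0 \<in> disturbance_set P" "obs_map0 P \<in> disturbance_set P \<rightarrow> observation_set P"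
    using system assms(1) by (auto simp: uncertain_system_def)
  with 0 show ?thesis by auto
next
  case (Suc j)
  then show ?thesis
    using system dist_seq_tuple[OF assms(1), of "Suc j"] tuples_take[OF assms(2), of "Suc j"]
      assms(3)
    unfolding uncertain_system_def by auto
qed

lemma memory_in_space:
  assumes "\<omega> \<in> sample_space P" "us \<in> tuples (action_set P) n"
  shows "memory P (dist_seq \<omega>) us \<in> memory_space P n"
proof -
  have "length us = n" using assms(2) by (simp add: tuples_def)
  then show ?thesis
    using assms obs_at_in[OF assms] cost_at_in[OF assms]
    by (auto simp: memory_def memory_space_def tuples_def simp flip: less_Suc_eq_le)
qed

lemma feasible_memory:
  assumes "\<omega> \<in> sample_space P" "us \<in> tuples (action_set P) n"
  shows "feasible P n (memory P (dist_seq \<omega>) us)"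
  using assms memory_in_space[OF assms] by (auto simp: feasible_def consistent_def)

lemma closed_loop_actions:
  assumes "\<omega> \<in> sample_space P" "us \<in> tuples (action_set P) n" "g \<in> strategies P"
  shows "closed_loop P g (dist_seq \<omega>) us k \<in> tuples (action_set P) (n + k)"
proof (induction k)
  case (Suc k)
  have len: "length us = n" using assms(2) by (simp add: tuples_def)
  show ?case
    using tuples_snoc[OF Suc] memory_in_space[OF assms(1) Suc] assms(3)
    by (auto simp: Let_def len strategies_def)
qed (use assms in simp)

section \<open>The cost-to-go\<close>

lemma feasibleD:
  assumes "feasible P t m"
  shows "past_actions m \<in> tuples (action_set P) t" "length (past_actions m) = t"
    and "\<exists>\<omega>. \<omega> \<in> consistent P m"
  using assms by (auto simp: feasible_def memory_space_def past_actions_def tuples_def)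

lemma consistentD:
  assumes "\<omega> \<in> consistent P m"
  shows "\<omega> \<in> sample_space P" "memory P (dist_seq \<omega>) (past_actions m) = m"
  using assms by (auto simp: consistent_def)

lemma stage_cost_in:
  assumes "\<omega> \<in> sample_space P" "us \<in> tuples (action_set P) t" "g \<in> strategies P"
  shows "cost_at P (dist_seq \<omega>) (closed_loop P g (dist_seq \<omega>) us (Suc k)) (t + k) \<in> cost_set P"
  by (rule cost_at_in[OF assms(1) closed_loop_actions[OF assms, of "Suc k"]]) simp

lemma summable_stage_costs:
  assumes "\<omega> \<in> sample_space P" "us \<in> tuples (action_set P) t" "g \<in> strategies P"
  shows "summable (\<lambda>k. \<gamma> ^ k *
           cost_at P (dist_seq \<omega>) (closed_loop P g (dist_seq \<omega>) us (Suc k)) (t + k))"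
proof (rule summable_comparison_test')
  show "summable (\<lambda>k. \<gamma> ^ k * cmax)"
    using discount by (intro summable_mult2 summable_geometric) auto
  show "norm (\<gamma> ^ k * cost_at P (dist_seq \<omega>) (closed_loop P g (dist_seq \<omega>) us (Suc k)) (t + k))
        \<le> \<gamma> ^ k * cmax" if "k \<ge> 0" for k
    using stage_cost_in[OF assms, of k] discount cost_nonneg le_cmax
    by (simp add: abs_mult)
qed

lemma cost_to_go_bounds:
  assumes "\<omega> \<in> sample_space P" "us \<in> tuples (action_set P) t" "g \<in> strategies P"
  shows "cmin / (1 - \<gamma>) \<le> cost_to_go P g t (dist_seq \<omega>) us"
    and "cost_to_go P g t (dist_seq \<omega>) us \<le> cmax / (1 - \<gamma>)"
proof -
  have sum: "summable (\<lambda>k. \<gamma> ^ k * c)" and geo: "(\<Sum>k. \<gamma> ^ k * c) = c / (1 - \<gamma>)" for c :: real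
    using discount suminf_mult2[OF summable_geometric[of \<gamma>], of c]
    by (auto intro!: summable_mult2 summable_geometric simp: suminf_geometric)
  show "cmin / (1 - \<gamma>) \<le> cost_to_go P g t (dist_seq \<omega>) us"
    unfolding cost_to_go_def geo[symmetric]
    using stage_cost_in[OF assms] discount cmin_le
    by (intro suminf_le sum summable_stage_costs[OF assms] mult_left_mono) auto
  show "cost_to_go P g t (dist_seq \<omega>) us \<le> cmax / (1 - \<gamma>)"
    unfolding cost_to_go_def geo[symmetric]
    using stage_cost_in[OF assms] discount le_cmax
    by (intro suminf_le sum summable_stage_costs[OF assms] mult_left_mono) auto
qed

lemma cost_to_go_step:
  assumes "\<omega> \<in> sample_space P" "us \<in> tuples (action_set P) t" "g \<in> strategies P"
    and u: "u = g t (memory P (dist_seq \<omega>) us)"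
  shows "cost_to_go P g t (dist_seq \<omega>) us =
         cost_at P (dist_seq \<omega>) (us @ [u]) t
           + \<gamma> * cost_to_go P g (Suc t) (dist_seq \<omega>) (us @ [u])"
proof -
  let ?w = "dist_seq \<omega>"
  let ?f = "\<lambda>k. \<gamma> ^ k * cost_at P ?w (closed_loop P g ?w us (Suc k)) (t + k)"
  let ?h = "\<lambda>k. \<gamma> ^ k * cost_at P ?w (closed_loop P g ?w (us @ [u]) (Suc k)) (Suc t + k)"
  have len: "length us = t" using assms(2) by (simp add: tuples_def)
  have acts: "us @ [u] \<in> tuples (action_set P) (Suc t)"
    using closed_loop_actions[OF assms(1-3), of 1] len u by simp
  have shift: "?f (Suc k) = \<gamma> * ?h k" for k
    using closed_loop_Suc_shift[of P g ?w us "Suc k"] len u by (simp add: mult.assoc)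
  have "suminf ?f = ?f 0 + (\<Sum>k. ?f (Suc k))"
    using suminf_split_head[OF summable_stage_costs[OF assms(1-3)]] by simp
  also have "(\<Sum>k. ?f (Suc k)) = \<gamma> * suminf ?h"
    unfolding shift by (rule suminf_mult[OF summable_stage_costs[OF assms(1) acts assms(3)]])
  also have "?f 0 = cost_at P ?w (us @ [u]) t"
    using len u by (simp add: Let_def)
  finally show ?thesis by (simp add: cost_to_go_def)
qed

text \<open>The costs that enter the accrued cost are recorded in the memory.\<close>

lemma accrued_range_singleton:
  assumes "feasible P t m"
  obtains a where "accrued_range P t m = {a}"
    and "\<And>\<omega>. \<omega> \<in> consistent P m \<Longrightarrow> accrued P t (dist_seq \<omega>) (past_actions m) = a"
proof -
  define a where "a = (\<Sum>l<t. \<gamma> ^ l * (fst (snd m)) ! l)"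
  have *: "accrued P t (dist_seq \<omega>) (past_actions m) = a" if "\<omega> \<in> consistent P m" for \<omega>
  proof -
    have "fst (snd m) = map (cost_at P (dist_seq \<omega>) (past_actions m)) [0..<t]"
      using consistentD(2)[OF that] feasibleD(2)[OF assms]
      by (metis memory_def fst_conv snd_conv)
    then show ?thesis by (simp add: accrued_def a_def)
  qed
  moreover have "accrued_range P t m = {a}"
    using * feasibleD(3)[OF assms] unfolding accrued_range_def cond_range_def
    by (force simp: image_iff)
  ultimately show thesis by (intro that) auto
qed

end

section \<open>Value iteration on the information state\<close>

locale information_state_system = cost_bounded_system P cmin cmax
  for P :: "('o, 'e::metric_space) system" and cmin cmax :: real +
  fixes S :: "'s::metric_space set"
    and \<sigma> :: "nat \<Rightarrow> 'e mem \<Rightarrow> 's"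
    and K :: "'s \<Rightarrow> 'e \<Rightarrow> (real \<times> 's) set"
  assumes info: "information_state P S \<sigma>"
    and invariant: "time_invariant_transition P S \<sigma> K"
begin

abbreviation value_iterate :: "nat \<Rightarrow> 's \<Rightarrow> real" where
  "value_iterate n \<equiv> (dp_operator P K ^^ n) (\<lambda>_. 0)"

abbreviation stage_value :: "nat \<Rightarrow> 's \<Rightarrow> 'e \<Rightarrow> real" where
  "stage_value n s u \<equiv> (SUP (c, s') \<in> K s u. c + \<gamma> * value_iterate n s')"

lemma state_in: "feasible P t m \<Longrightarrow> \<sigma> t m \<in> S"
  using info by (auto simp: information_state_def feasible_def)

lemma kernel:
  assumes "s \<in> S" "u \<in> action_set P"
  shows "K s u \<noteq> {}" "K s u \<subseteq> cost_set P \<times> S"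
  using invariant assms by (auto simp: time_invariant_transition_def)

lemma kernel_eq:
  assumes "feasible P t m" "u \<in> action_set P"
  shows "K (\<sigma> t m) u = (\<lambda>\<omega>. (cost_at P (dist_seq \<omega>) (past_actions m @ [u]) t,
            \<sigma> (Suc t) (memory P (dist_seq \<omega>) (past_actions m @ [u])))) ` consistent P m"
proof -
  have "K (\<sigma> t m) u = mem_transition P \<sigma> t m u"
    using info invariant assms
    unfolding information_state_def time_invariant_transition_def by metis
  then show ?thesis by (simp add: mem_transition_def cond_range_def Let_def)
qed

lemma action_set_nonempty: "action_set P \<noteq> {}"
  using system by (simp add: uncertain_system_def)

lemma value_iterate_Suc:
  "value_iterate (Suc n) s = (INF u\<in>action_set P. stage_value n s u)"
  by (simp only: funpow.simps o_apply dp_operator_def[of P K "value_iterate n"])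

text \<open>On \<open>S\<close> the suprema and infima in the operator range over bounded nonempty families, so
  they are genuine least upper and greatest lower bounds.\<close>

lemma value_iterate_bounds:
  "s \<in> S \<Longrightarrow> 0 \<le> value_iterate n s \<and> value_iterate n s \<le> cmax / (1 - \<gamma>)"
proof (induction n arbitrary: s)
  case 0
  show ?case using discount cost_nonneg[OF cmax_in] by simp
next
  case (Suc n)
  let ?F = "\<lambda>(c, s'). c + \<gamma> * value_iterate n s'"
  have F: "0 \<le> ?F p \<and> ?F p \<le> cmax / (1 - \<gamma>)" if u: "u \<in> action_set P" and p: "p \<in> K s u" for u p
  proof -
    obtain c s' where cs: "p = (c, s')" "c \<in> cost_set P" "s' \<in> S"
      using kernel(2)[OF Suc.prems u] p by auto
    have "c + \<gamma> * value_iterate n s' \<le> cmax + \<gamma> * (cmax / (1 - \<gamma>))"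
      using Suc.IH[OF cs(3)] le_cmax[OF cs(2)] discount by (intro add_mono mult_left_mono) auto
    also have "\<dots> = cmax / (1 - \<gamma>)" using discount by (simp add: field_simps)
    finally show ?thesis
      using Suc.IH[OF cs(3)] cost_nonneg[OF cs(2)] discount cs(1) by simp
  qed
  have G: "0 \<le> stage_value n s u \<and> stage_value n s u \<le> cmax / (1 - \<gamma>)" if u: "u \<in> action_set P" for u
  proof -
    obtain p where p: "p \<in> K s u" using kernel(1)[OF Suc.prems u] by auto
    have "bdd_above (?F ` K s u)" using F[OF u] by (intro bdd_aboveI2) auto
    then have "0 \<le> stage_value n s u" using F[OF u p] cSUP_upper2[OF _ p, of ?F 0] by auto
    moreover have "stage_value n s u \<le> cmax / (1 - \<gamma>)"
      using F[OF u] kernel(1)[OF Suc.prems u] by (intro cSUP_least) auto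
    ultimately show ?thesis by simp
  qed
  obtain u where u: "u \<in> action_set P" using action_set_nonempty by auto
  have "bdd_below (stage_value n s ` action_set P)" using G by (intro bdd_belowI2) auto
  then have "(INF u\<in>action_set P. stage_value n s u) \<le> cmax / (1 - \<gamma>)"
    using G u by (intro cINF_lower2[of _ _ u]) auto
  moreover have "0 \<le> (INF u\<in>action_set P. stage_value n s u)"
    using G action_set_nonempty by (intro cINF_greatest) auto
  ultimately show ?case unfolding value_iterate_Suc by simp
qed

lemma le_stage_value:
  assumes "s \<in> S" "u \<in> action_set P" "(c, s') \<in> K s u"
  shows "c + \<gamma> * value_iterate n s' \<le> stage_value n s u"
proof -
  have "bdd_above ((\<lambda>(c, s'). c + \<gamma> * value_iterate n s') ` K s u)"
  proof (rule bdd_aboveI2)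
    fix p assume "p \<in> K s u"
    then obtain c s' where cs: "p = (c, s')" "c \<in> cost_set P" "s' \<in> S"
      using kernel(2)[OF assms(1,2)] by auto
    have "c + \<gamma> * value_iterate n s' \<le> cmax + \<gamma> * (cmax / (1 - \<gamma>))"
      using value_iterate_bounds[OF cs(3), of n] le_cmax[OF cs(2)] discount
      by (intro add_mono mult_left_mono) auto
    then show "(case p of (c, s') \<Rightarrow> c + \<gamma> * value_iterate n s') \<le> cmax + \<gamma> * (cmax / (1 - \<gamma>))"
      by (simp add: cs(1))
  qed
  from cSUP_upper[OF assms(3) this] show ?thesis by simp
qed

lemma stage_value_nonneg:
  assumes "s \<in> S" "u \<in> action_set P"
  shows "0 \<le> stage_value n s u"
proof -
  obtain c s' where cs: "(c, s') \<in> K s u" "c \<in> cost_set P" "s' \<in> S"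
    using kernel[OF assms] by auto
  have "0 \<le> c + \<gamma> * value_iterate n s'"
    using value_iterate_bounds[OF cs(3), of n] cost_nonneg[OF cs(2)] discount by simp
  also note le_stage_value[OF assms cs(1)]
  finally show ?thesis .
qed

lemma value_iterate_Suc_le:
  assumes "s \<in> S" "u \<in> action_set P"
  shows "value_iterate (Suc n) s \<le> stage_value n s u"
proof -
  have "bdd_below (stage_value n s ` action_set P)"
    using stage_value_nonneg[OF assms(1)] by (intro bdd_belowI2) auto
  from cINF_lower[OF this assms(2)] show ?thesis unfolding value_iterate_Suc .
qed

section \<open>Lower bound for every strategy\<close>

text \<open>Stating the bound for all upper bounds \<open>B\<close> instead of the supremum lets the induction
  pass to a successor memory by rescaling: \<open>(B - c) / \<gamma>\<close> is an upper bound there.\<close>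

lemma value_iterate_le_cost_bound:
  assumes g: "g \<in> strategies P" and "feasible P t m"
    and "\<And>\<omega>. \<omega> \<in> consistent P m \<Longrightarrow> cost_to_go P g t (dist_seq \<omega>) (past_actions m) \<le> B"
  shows "value_iterate n (\<sigma> t m) + \<gamma> ^ n * cmin / (1 - \<gamma>) \<le> B"
  using assms(2,3)
proof (induction n arbitrary: t m B)
  case 0
  obtain \<omega> where \<omega>: "\<omega> \<in> consistent P m" using feasibleD(3)[OF 0(1)] by auto
  have "cmin / (1 - \<gamma>) \<le> B"
    using cost_to_go_bounds(1)[OF consistentD(1)[OF \<omega>] feasibleD(1)[OF 0(1)] g] 0(2)[OF \<omega>] by simp
  then show ?case by simp
next
  case (Suc n)
  note feas = Suc.prems(1)
  define us where "us = past_actions m"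
  define u where "u = g t m"
  have u_in: "u \<in> action_set P"
    using g feas by (auto simp: u_def strategies_def feasible_def)
  have us: "us \<in> tuples (action_set P) t" "length us = t"
    using feasibleD[OF feas] by (auto simp: us_def)
  have us': "us @ [u] \<in> tuples (action_set P) (Suc t)"
    using tuples_snoc[OF us(1) u_in] .
  have bound: "c + \<gamma> * value_iterate n s' \<le> B - \<gamma> ^ Suc n * cmin / (1 - \<gamma>)"
    if cs: "(c, s') \<in> K (\<sigma> t m) u" for c s'
  proof -
    obtain \<omega> where \<omega>: "\<omega> \<in> consistent P m"
      and c: "c = cost_at P (dist_seq \<omega>) (us @ [u]) t"
      and s': "s' = \<sigma> (Suc t) (memory P (dist_seq \<omega>) (us @ [u]))"
      using cs unfolding kernel_eq[OF feas u_in] us_def by auto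
    define m' where "m' = memory P (dist_seq \<omega>) (us @ [u])"
    have feas': "feasible P (Suc t) m'"
      using feasible_memory[OF consistentD(1)[OF \<omega>] us'] by (simp add: m'_def)
    have "value_iterate n (\<sigma> (Suc t) m') + \<gamma> ^ n * cmin / (1 - \<gamma>) \<le> (B - c) / \<gamma>"
    proof (rule Suc.IH[OF feas'])
      fix \<omega>' assume \<omega>': "\<omega>' \<in> consistent P m'"
      have mem: "memory P (dist_seq \<omega>') (us @ [u]) = memory P (dist_seq \<omega>) (us @ [u])"
        using consistentD(2)[OF \<omega>'] by (simp add: m'_def)
      have mem_m: "memory P (dist_seq \<omega>') us = m"
        using memory_eq_butlast(1)[OF mem] consistentD(2)[OF \<omega>] by (simp add: us_def)
      have cons: "\<omega>' \<in> consistent P m"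
        using mem_m consistentD(1)[OF \<omega>'] by (simp add: consistent_def us_def)
      have "cost_at P (dist_seq \<omega>') (us @ [u]) t = c"
        using memory_eq_butlast(2)[OF mem] us(2) c by simp
      then have "c + \<gamma> * cost_to_go P g (Suc t) (dist_seq \<omega>') (us @ [u]) \<le> B"
        using cost_to_go_step[OF consistentD(1)[OF cons] us(1) g, of u] mem_m Suc.prems(2)[OF cons]
        by (simp add: u_def us_def)
      then show "cost_to_go P g (Suc t) (dist_seq \<omega>') (past_actions m') \<le> (B - c) / \<gamma>"
        using discount by (simp add: m'_def field_simps)
    qed
    then have "\<gamma> * (value_iterate n s' + \<gamma> ^ n * cmin / (1 - \<gamma>)) \<le> B - c"
      using discount s' by (simp add: m'_def pos_le_divide_eq mult.commute)
    then show ?thesis by (simp add: algebra_simps)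
  qed
  have "value_iterate (Suc n) (\<sigma> t m) \<le> stage_value n (\<sigma> t m) u"
    by (rule value_iterate_Suc_le[OF state_in[OF feas] u_in])
  also have "\<dots> \<le> B - \<gamma> ^ Suc n * cmin / (1 - \<gamma>)"
    using kernel(1)[OF state_in[OF feas] u_in] bound by (intro cSUP_least) auto
  finally show ?case by simp
qed

section \<open>Upper bound by a greedy strategy\<close>

definition greedy_action :: "real \<Rightarrow> nat \<Rightarrow> 's \<Rightarrow> 'e" where
  "greedy_action \<epsilon> n s =
     (SOME u. u \<in> action_set P \<and> (s \<in> S \<longrightarrow> stage_value n s u \<le> value_iterate (Suc n) s + \<epsilon>))"

text \<open>The action at time \<open>t\<close> minimizes the iterate with \<open>T - t\<close> steps to go, whose stage value
  involves the iterate with one step less; from time \<open>T\<close> on any action will do.\<close>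

definition greedy_strategy :: "real \<Rightarrow> nat \<Rightarrow> nat \<Rightarrow> 'e mem \<Rightarrow> 'e" where
  "greedy_strategy \<epsilon> T t m = greedy_action \<epsilon> (T - Suc t) (\<sigma> t m)"

lemma greedy_action:
  assumes "\<epsilon> > 0"
  shows "greedy_action \<epsilon> n s \<in> action_set P"
    and "s \<in> S \<Longrightarrow> stage_value n s (greedy_action \<epsilon> n s) \<le> value_iterate (Suc n) s + \<epsilon>"
proof -
  have "\<exists>u. u \<in> action_set P \<and> (s \<in> S \<longrightarrow> stage_value n s u \<le> value_iterate (Suc n) s + \<epsilon>)"
  proof (cases "s \<in> S")
    case True
    have "bdd_below (stage_value n s ` action_set P)"
      using stage_value_nonneg[OF True] by (intro bdd_belowI2) auto
    then have "\<exists>u\<in>action_set P. stage_value n s u < value_iterate (Suc n) s + \<epsilon>"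
      using cINF_less_iff[OF action_set_nonempty, of "stage_value n s" "value_iterate (Suc n) s + \<epsilon>"]
        assms value_iterate_Suc[of n s] by simp
    then show ?thesis by (auto intro: less_imp_le)
  qed (use action_set_nonempty in auto)
  from someI_ex[OF this]
  show "greedy_action \<epsilon> n s \<in> action_set P"
    and "s \<in> S \<Longrightarrow> stage_value n s (greedy_action \<epsilon> n s) \<le> value_iterate (Suc n) s + \<epsilon>"
    by (auto simp: greedy_action_def)
qed

lemma greedy_strategy_in: "\<epsilon> > 0 \<Longrightarrow> greedy_strategy \<epsilon> T \<in> strategies P"
  by (auto simp: strategies_def greedy_strategy_def greedy_action(1))

lemma greedy_cost_to_go_le:
  assumes "\<epsilon> > 0" and "feasible P t m" and "\<omega> \<in> consistent P m" and "t + n = T"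
  shows "cost_to_go P (greedy_strategy \<epsilon> T) t (dist_seq \<omega>) (past_actions m)
         \<le> value_iterate n (\<sigma> t m) + \<epsilon> / (1 - \<gamma>) + \<gamma> ^ n * cmax / (1 - \<gamma>)"
  using assms(2-4)
proof (induction n arbitrary: t m)
  case 0
  have "0 \<le> \<epsilon> / (1 - \<gamma>)" using assms(1) discount by simp
  then show ?case
    using cost_to_go_bounds(2)[OF consistentD(1)[OF 0(2)] feasibleD(1)[OF 0(1)]
        greedy_strategy_in[OF assms(1), of T]] by simp
next
  case (Suc n)
  define us where "us = past_actions m"
  define u where "u = greedy_strategy \<epsilon> T t m"
  define m' where "m' = memory P (dist_seq \<omega>) (us @ [u])"
  define c where "c = cost_at P (dist_seq \<omega>) (us @ [u]) t"
  note feas = Suc.prems(1) and \<omega> = Suc.prems(2)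
  have u: "u = greedy_action \<epsilon> n (\<sigma> t m)"
    using Suc.prems(3) by (auto simp: u_def greedy_strategy_def)
  have u_in: "u \<in> action_set P" unfolding u by (rule greedy_action(1)[OF assms(1)])
  have us: "us \<in> tuples (action_set P) t" using feasibleD[OF feas] by (simp add: us_def)
  have mem: "memory P (dist_seq \<omega>) us = m" using consistentD(2)[OF \<omega>] by (simp add: us_def)
  have feas': "feasible P (Suc t) m'"
    using feasible_memory[OF consistentD(1)[OF \<omega>] tuples_snoc[OF us u_in]] by (simp add: m'_def)
  have cons': "\<omega> \<in> consistent P m'"
    using consistentD(1)[OF \<omega>] by (simp add: m'_def consistent_def)
  have trans: "(c, \<sigma> (Suc t) m') \<in> K (\<sigma> t m) u"
    using \<omega> unfolding kernel_eq[OF feas u_in] by (auto simp: c_def m'_def us_def)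
  have IH: "cost_to_go P (greedy_strategy \<epsilon> T) (Suc t) (dist_seq \<omega>) (us @ [u])
        \<le> value_iterate n (\<sigma> (Suc t) m') + \<epsilon> / (1 - \<gamma>) + \<gamma> ^ n * cmax / (1 - \<gamma>)"
    using Suc.IH[OF feas' cons'] Suc.prems(3) by (simp add: m'_def)
  have "cost_to_go P (greedy_strategy \<epsilon> T) t (dist_seq \<omega>) us
      = c + \<gamma> * cost_to_go P (greedy_strategy \<epsilon> T) (Suc t) (dist_seq \<omega>) (us @ [u])"
    using cost_to_go_step[OF consistentD(1)[OF \<omega>] us greedy_strategy_in[OF assms(1)], of u T] mem
    by (simp add: u_def c_def)
  also have "\<dots> \<le> c + \<gamma> * (value_iterate n (\<sigma> (Suc t) m') + \<epsilon> / (1 - \<gamma>) + \<gamma> ^ n * cmax / (1 - \<gamma>))"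
    using IH discount by (intro add_left_mono mult_left_mono) auto
  also have "\<dots> = c + \<gamma> * value_iterate n (\<sigma> (Suc t) m')
      + \<gamma> * (\<epsilon> / (1 - \<gamma>)) + \<gamma> ^ Suc n * cmax / (1 - \<gamma>)"
    by (simp add: algebra_simps)
  also have "\<dots> \<le> value_iterate (Suc n) (\<sigma> t m) + \<epsilon>
      + \<gamma> * (\<epsilon> / (1 - \<gamma>)) + \<gamma> ^ Suc n * cmax / (1 - \<gamma>)"
    using le_stage_value[OF state_in[OF feas] u_in trans, of n]
      greedy_action(2)[OF assms(1) state_in[OF feas], of n] u by simp
  (* The slack reproduces itself: eps + gamma * eps / (1 - gamma) = eps / (1 - gamma). *)
  also have "\<dots> = value_iterate (Suc n) (\<sigma> t m) + \<epsilon> / (1 - \<gamma>) + \<gamma> ^ Suc n * cmax / (1 - \<gamma>)"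
  proof -
    have "\<epsilon> + \<gamma> * (\<epsilon> / (1 - \<gamma>)) = \<epsilon> / (1 - \<gamma>)" using discount by (simp add: field_simps)
    then show ?thesis by simp
  qed
  finally show ?case by (simp add: us_def)
qed

section \<open>Bounds on the optimal value\<close>

lemma optimal_value_bounds:
  assumes feas: "feasible P t m"
  shows "\<gamma> ^ (n + t) * cmin / (1 - \<gamma>) + \<gamma> ^ t * value_iterate n (\<sigma> t m)
           + Sup (accrued_range P t m) \<le> optimal_value P t m"
    and "optimal_value P t m \<le> Sup (accrued_range P t m)
           + \<gamma> ^ t * value_iterate n (\<sigma> t m) + \<gamma> ^ (n + t) * cmax / (1 - \<gamma>)"
proof -
  obtain a where range: "accrued_range P t m = {a}"
    and a: "\<And>\<omega>. \<omega> \<in> consistent P m \<Longrightarrow> accrued P t (dist_seq \<omega>) (past_actions m) = a"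
    using accrued_range_singleton[OF feas] by blast
  define L where "L = a + \<gamma> ^ t * (value_iterate n (\<sigma> t m) + \<gamma> ^ n * cmin / (1 - \<gamma>))"
  have pos: "0 < \<gamma> ^ t" using discount by simp
  have nonempty: "consistent P m \<noteq> {}" using feasibleD(3)[OF feas] by auto
  have value_eq: "strategy_value P g t m =
      (SUP \<omega>\<in>consistent P m. a + \<gamma> ^ t * cost_to_go P g t (dist_seq \<omega>) (past_actions m))" for g
    unfolding strategy_value_def cond_range_def image_image
    by (rule SUP_cong) (auto simp: a)
  have L_le: "L \<le> strategy_value P g t m" if g: "g \<in> strategies P" for g
  proof -
    let ?V = "strategy_value P g t m"
    have bdd: "bdd_above ((\<lambda>\<omega>. a + \<gamma> ^ t * cost_to_go P g t (dist_seq \<omega>) (past_actions m))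
        ` consistent P m)"
      using cost_to_go_bounds(2)[OF consistentD(1) feasibleD(1)[OF feas] g] pos
      by (intro bdd_aboveI2[where M = "a + \<gamma> ^ t * (cmax / (1 - \<gamma>))"] add_left_mono mult_left_mono)
        auto
    have "value_iterate n (\<sigma> t m) + \<gamma> ^ n * cmin / (1 - \<gamma>) \<le> (?V - a) / \<gamma> ^ t"
    proof (rule value_iterate_le_cost_bound[OF g feas])
      fix \<omega> assume "\<omega> \<in> consistent P m"
      from cSUP_upper[OF this bdd]
      show "cost_to_go P g t (dist_seq \<omega>) (past_actions m) \<le> (?V - a) / \<gamma> ^ t"
        using pos by (simp add: value_eq pos_le_divide_eq algebra_simps)
    qed
    then show ?thesis using pos by (simp add: L_def pos_le_divide_eq algebra_simps)
  qed
  have "L \<le> optimal_value P t m"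
    unfolding optimal_value_def using L_le greedy_strategy_in[of 1] by (intro cINF_greatest) auto
  then show "\<gamma> ^ (n + t) * cmin / (1 - \<gamma>) + \<gamma> ^ t * value_iterate n (\<sigma> t m)
           + Sup (accrued_range P t m) \<le> optimal_value P t m"
    by (simp add: L_def range power_add algebra_simps)
  have "optimal_value P t m \<le> a + \<gamma> ^ t * value_iterate n (\<sigma> t m) + \<gamma> ^ (n + t) * cmax / (1 - \<gamma>)"
  proof (rule field_le_epsilon)
    fix e :: real assume "0 < e"
    (* Chosen so that the total slack, discounted to time 0, is exactly e. *)
    define \<epsilon> where "\<epsilon> = e * (1 - \<gamma>) / \<gamma> ^ t"
    define g where "g = greedy_strategy \<epsilon> (t + n)"
    have \<epsilon>: "\<epsilon> > 0" using \<open>0 < e\<close> pos discount by (simp add: \<epsilon>_def)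
    have slack: "\<gamma> ^ t * (\<epsilon> / (1 - \<gamma>)) = e" using pos discount by (simp add: \<epsilon>_def)
    have g: "g \<in> strategies P" unfolding g_def by (rule greedy_strategy_in[OF \<epsilon>])
    have "optimal_value P t m \<le> strategy_value P g t m"
      unfolding optimal_value_def using L_le g by (intro cINF_lower bdd_belowI2) auto
    also have "\<dots> \<le> a + \<gamma> ^ t * (value_iterate n (\<sigma> t m) + \<epsilon> / (1 - \<gamma>) + \<gamma> ^ n * cmax / (1 - \<gamma>))"
      unfolding value_eq g_def using greedy_cost_to_go_le[OF \<epsilon> feas] pos nonempty
      by (intro cSUP_least add_left_mono mult_left_mono) auto
    also have "\<dots> = a + \<gamma> ^ t * value_iterate n (\<sigma> t m) + \<gamma> ^ (n + t) * cmax / (1 - \<gamma>) + e"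
      unfolding slack[symmetric] by (simp add: power_add algebra_simps)
    finally show "optimal_value P t m
        \<le> a + \<gamma> ^ t * value_iterate n (\<sigma> t m) + \<gamma> ^ (n + t) * cmax / (1 - \<gamma>) + e" .
  qed
  then show "optimal_value P t m \<le> Sup (accrued_range P t m)
           + \<gamma> ^ t * value_iterate n (\<sigma> t m) + \<gamma> ^ (n + t) * cmax / (1 - \<gamma>)"
    by (simp add: range)
qed

end

theorem theorem2:
  fixes P :: "('o, 'e::metric_space) system"
    and S :: "'s::metric_space set"
    and \<sigma> :: "nat \<Rightarrow> 'e mem \<Rightarrow> 's"
    and K :: "'s \<Rightarrow> 'e \<Rightarrow> (real \<times> 's) set"
    and cmin cmax :: real
    and n t :: nat
    and m :: "'e mem"
  assumes "uncertain_system P"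
    and "cmin \<in> cost_set P" and "\<forall>c \<in> cost_set P. cmin \<le> c"
    and "cmax \<in> cost_set P" and "\<forall>c \<in> cost_set P. c \<le> cmax"
    and "information_state P S \<sigma>"
    and "time_invariant_transition P S \<sigma> K"
    and "feasible P t m"
  shows "discount P ^ (n + t) * cmin / (1 - discount P)
           + discount P ^ t * (dp_operator P K ^^ n) (\<lambda>_. 0) (\<sigma> t m)
           + Sup (accrued_range P t m)
         \<le> optimal_value P t m
       \<and> optimal_value P t m
         \<le> Sup (accrued_range P t m)
           + discount P ^ t * (dp_operator P K ^^ n) (\<lambda>_. 0) (\<sigma> t m)
           + discount P ^ (n + t) * cmax / (1 - discount P)"
proof -
  interpret information_state_system P cmin cmax S \<sigma> K
    using assms by unfold_locales auto
  show ?thesis using optimal_value_bounds[OF assms(8)] by blast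
qed

end
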